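(* Let $f$ be a transcendental entire function with maximum modulus function $M(r)=\max_{|z|=r}|f(z)|$. Let $R_0>0$ and let $\epsilon:[R_0,\infty)\to(0,1)$ be a nonincreasing function such that $$\epsilon(M^n(r))\geq \epsilon(r)^{n+1},\quad\text{for all } r\geq R_0 \text{ and } n\in\mathbb{N}.$$ Define $\eta(r)=\epsilon(r)M(r)$ for $r\geq R_0$. Then there exists $R_1\geq R_0$ such that, for every $R'\geq R_1$, $$A(f)=\{z : \text{there exists } \ell\in\mathbb{N}\text{ such that } |f^{n+\ell}(z)|\geq \eta^n(R') \text{ for all } n\in\mathbb{N}\}.$$
   Context: $M^n(r)$ and $\eta^n(r)$ denote the $n$-th iterates of the functions $r\mapsto M(r)$ and $r\mapsto\eta(r)$. The displayed hypothesis on $\epsilon$ is understood to include that $M^n(r)\geq R_0$ for $r\ge R_0$, so that $\epsilon(M^n(r))$ makes sense; similarly, part of the conclusion is that $\eta^n(R')$ is defined for all $n$ when $R'\geq R_1$. The fast escaping set of $f$ is $$A(f)=\{z : \text{there exists } \ell\in\mathbb{N} \text{ such that } |f^{n+\ell}(z)|\geq M^n(R) \text{ for all } n\in\mathbb{N}\},$$ where $R>0$ is any value such that $M(r)>r$ for all $r\geq R$ (the set does not depend on the choice of such an $R$). Here $\mathbb{N}=\{1,2,\ldots\}$. *)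

theory Defs
  imports "HOL-Complex_Analysis.Complex_Analysis"
begin

definition transcendental_entire :: "(complex \<Rightarrow> complex) \<Rightarrow> bool" where
  "transcendental_entire f \<longleftrightarrow>
     f holomorphic_on UNIV \<and> \<not> (\<exists>p :: complex poly. \<forall>z. f z = poly p z)"

text \<open>The supremum is a maximum whenever \<open>f\<close> is continuous on the circle and \<open>r \<ge> 0\<close>
  (lemma \<open>max_modulus_attained\<close>). For \<open>r < 0\<close> the circle is empty and the value is irrelevant.\<close>

definition max_modulus :: "(complex \<Rightarrow> complex) \<Rightarrow> real \<Rightarrow> real" where
  "max_modulus f r = (SUP z\<in>sphere 0 r. norm (f z))"

lemma max_modulus_attained:
  assumes "continuous_on (sphere 0 r) f" and "r \<ge> 0"
  obtains z where "norm z = r" "max_modulus f r = norm (f z)"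
    "\<And>w. norm w = r \<Longrightarrow> norm (f w) \<le> max_modulus f r"
proof -
  have "complex_of_real r \<in> sphere 0 r"
    using assms(2) by simp
  then have "sphere (0::complex) r \<noteq> {}"
    by blast
  moreover have "continuous_on (sphere 0 r) (\<lambda>z. norm (f z))"
    using assms(1) by (intro continuous_intros)
  ultimately obtain z where z: "z \<in> sphere 0 r" "\<forall>w\<in>sphere 0 r. norm (f w) \<le> norm (f z)"
    using continuous_attains_sup[of "sphere (0::complex) r" "\<lambda>z. norm (f z)"] by auto
  have "max_modulus f r = norm (f z)"
    unfolding max_modulus_def using z by (intro cSup_eq_maximum) auto
  with z show ?thesis
    by (intro that[of z]) auto
qed

text \<open>The fast escaping set \<open>A(f)\<close>, formed with a base level \<open>R\<close>. It is meant for those \<open>R > 0\<close> with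
  \<open>max_modulus f r > r\<close> for all \<open>r \<ge> R\<close>; all such \<open>R\<close> give the same set when \<open>f\<close> is
  transcendental entire. The conditions \<open>l \<ge> 1\<close> and \<open>n \<ge> 1\<close> reflect the convention that the
  natural numbers start at 1.\<close>

definition admissible_level :: "(complex \<Rightarrow> complex) \<Rightarrow> real \<Rightarrow> bool" where
  "admissible_level f R \<longleftrightarrow> R > 0 \<and> (\<forall>r\<ge>R. max_modulus f r > r)"

definition fast_escaping_set :: "(complex \<Rightarrow> complex) \<Rightarrow> real \<Rightarrow> complex set" where
  "fast_escaping_set f R =
     {z. \<exists>l\<ge>1. \<forall>n\<ge>1. norm ((f ^^ (n + l)) z) \<ge> (max_modulus f ^^ n) R}"

end

theory Submission
  imports Defs
begin

text \<open>
  One inclusion only needs \<open>\<eta> \<le> M\<close>. For the other one, write \<open>f(z) = a + b z + c z\<^sup>2 + z\<^sup>3 g(z)\<close>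
  with \<open>g\<close> entire. Since the maximum modulus of \<open>g\<close> is nondecreasing and unbounded,
  \<open>M(\<lambda> r) \<ge> \<lambda>\<^sup>3 M(r) / 3\<close> for \<open>\<lambda> \<ge> 1\<close> and all large \<open>r\<close>. Put \<open>\<delta> = \<epsilon>(R')\<close> and \<open>s = \<delta> R' / 3\<close>. As
  \<open>\<eta>\<^sup>n(R') \<le> M\<^sup>n(R')\<close>, the hypothesis gives \<open>\<eta>\<^sup>n\<^sup>+\<^sup>1(R') \<ge> \<delta>\<^sup>n\<^sup>+\<^sup>1 M(\<eta>\<^sup>n(R'))\<close>, and the cubic factor
  \<open>\<lambda>\<^sup>3\<close> more than compensates for \<open>\<delta>\<^sup>n\<^sup>+\<^sup>1\<close>: by induction \<open>\<eta>\<^sup>n(R') \<ge> (3/\<delta>)\<^sup>n\<^sup>+\<^sup>1 M\<^sup>n(s)\<close>. It remains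
  to see that \<open>s\<close> is large when \<open>R'\<close> is; along the orbit \<open>M\<^sup>k(S)\<close> of a fixed large \<open>S\<close>, \<open>\<epsilon>\<close> decays
  at most like \<open>\<epsilon>(S)\<^sup>k\<^sup>+\<^sup>1\<close> while \<open>M\<^sup>k(S)\<close> grows faster than any geometric sequence.
\<close>

section \<open>The maximum modulus of an entire function\<close>

text \<open>The maximum modulus principle carries the bound from the circle of radius
  \<open>r\<close> to the closed disc.\<close>

lemma max_modulus_ge:
  assumes "f holomorphic_on UNIV" and "norm z \<le> r"
  shows "norm (f z) \<le> max_modulus f r"
proof (cases "r = 0")
  case True
  then show ?thesis
    using assms by (simp add: max_modulus_def)
next
  case False
  have r: "r > 0"
    using False assms(2) norm_ge_zero[of z] by linarith
  have cont: "continuous_on A f" for A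
    using assms(1) holomorphic_on_imp_continuous_on holomorphic_on_subset by blast
  obtain "\<And>w. norm w = r \<Longrightarrow> norm (f w) \<le> max_modulus f r"
    using max_modulus_attained[OF cont] r by (metis less_imp_le)
  then show ?thesis
    using maximum_modulus_frontier[of f "cball 0 r" "max_modulus f r" z] assms r cont
    by (auto intro: holomorphic_on_subset simp: frontier_cball)
qed

lemma max_modulus_obtains:
  assumes "f holomorphic_on UNIV" and "r \<ge> 0"
  obtains z where "norm z = r" "max_modulus f r = norm (f z)"
proof -
  have "continuous_on (sphere 0 r) f"
    using assms(1) holomorphic_on_imp_continuous_on holomorphic_on_subset by blast
  then show ?thesis
    using max_modulus_attained[of r f] assms(2) that by metis
qed

lemma max_modulus_nonneg:
  assumes "f holomorphic_on UNIV" and "r \<ge> 0"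
  shows "max_modulus f r \<ge> 0"
proof -
  obtain z where "max_modulus f r = norm (f z)"
    using max_modulus_obtains[OF assms] by blast
  then show ?thesis
    by simp
qed

lemma max_modulus_mono:
  assumes "f holomorphic_on UNIV" and "0 \<le> r" and "r \<le> s"
  shows "max_modulus f r \<le> max_modulus f s"
proof -
  obtain z where "norm z = r" "max_modulus f r = norm (f z)"
    using max_modulus_obtains[OF assms(1,2)] by blast
  then show ?thesis
    using max_modulus_ge[OF assms(1), of z s] assms(3) by simp
qed

lemma max_modulus_le_iterates:
  assumes "f holomorphic_on UNIV" and "0 \<le> r" and "r \<le> s"
  shows "0 \<le> (max_modulus f ^^ n) r \<and> (max_modulus f ^^ n) r \<le> (max_modulus f ^^ n) s"
proof (induction n)
  case (Suc n)
  then show ?case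
    using max_modulus_mono[OF assms(1)] max_modulus_nonneg[OF assms(1)] by simp
qed (use assms in simp)

section \<open>Growth of transcendental entire functions\<close>

lemma transcendental_entire_factor:
  assumes "transcendental_entire f"
  obtains g where "transcendental_entire g" "\<And>z. f z = f 0 + z * g z"
proof -
  define g where "g = (\<lambda>z. if z = 0 then deriv f 0 else (f z - f 0) / (z - 0))"
  have eq: "f z = f 0 + z * g z" for z
    by (simp add: g_def)
  \<comment> \<open>The difference quotient at 0 has a removable singularity, filled in by the
    derivative.\<close>
  have "g holomorphic_on UNIV"
    unfolding g_def using assms by (intro pole_lemma_open) (auto simp: transcendental_entire_def)
  moreover have "\<not> (\<exists>p. \<forall>z. g z = poly p z)"
  proof
    assume "\<exists>p. \<forall>z. g z = poly p z"
    then obtain p where "\<And>z. g z = poly p z"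
      by blast
    then have "f z = poly (pCons (f 0) p) z" for z
      using eq[of z] by simp
    then show False
      using assms unfolding transcendental_entire_def by blast
  qed
  ultimately have "transcendental_entire g"
    by (simp add: transcendental_entire_def)
  then show ?thesis
    using eq by (rule that)
qed

text \<open>Liouville gives one point with value above \<open>B\<close>; by the maximum principle
  that value bounds every larger circle from below.\<close>

lemma max_modulus_unbounded:
  assumes "transcendental_entire g"
  obtains X where "X \<ge> 1" "\<And>r. r \<ge> X \<Longrightarrow> max_modulus g r \<ge> B"
proof -
  have hol: "g holomorphic_on UNIV"
    using assms by (simp add: transcendental_entire_def)
  have "\<not> bounded (range g)"
  proof
    assume "bounded (range g)"
    then obtain c where "\<And>z. g z = c"
      using Liouville_theorem[OF hol] by (auto simp: constant_on_def)
    then have "\<forall>z. g z = poly [:c:] z"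
      by simp
    then show False
      using assms unfolding transcendental_entire_def by blast
  qed
  then obtain z where z: "norm (g z) > B"
    by (force simp: bounded_iff not_le)
  show ?thesis
  proof (rule that[of "max 1 (norm z)"])
    show "max_modulus g r \<ge> B" if "r \<ge> max 1 (norm z)" for r
      using max_modulus_ge[OF hol, of z r] z that by simp
  qed simp
qed

text \<open>Factoring out \<open>z\<close> three times leaves a quadratic polynomial of size at most
  \<open>C * r ^ 2\<close>. Once the maximum modulus of \<open>g\<close> reaches
  \<open>2 * C\<close>, this is at most half of the cubic term.\<close>

lemma max_modulus_cubic_bounds:
  assumes "transcendental_entire f"
  obtains g X where "transcendental_entire g" "X \<ge> 1"
    "\<And>r. r \<ge> X \<Longrightarrow> r ^ 3 * max_modulus g r / 2 \<le> max_modulus f r"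
    "\<And>r. r \<ge> X \<Longrightarrow> max_modulus f r \<le> 3 / 2 * (r ^ 3 * max_modulus g r)"
proof -
  obtain f1 where f1: "transcendental_entire f1" "\<And>z. f z = f 0 + z * f1 z"
    using transcendental_entire_factor[OF assms] by blast
  obtain f2 where f2: "transcendental_entire f2" "\<And>z. f1 z = f1 0 + z * f2 z"
    using transcendental_entire_factor[OF f1(1)] by blast
  obtain g where g: "transcendental_entire g" "\<And>z. f2 z = f2 0 + z * g z"
    using transcendental_entire_factor[OF f2(1)] by blast
  define p where "p z = f 0 + f1 0 * z + f2 0 * z ^ 2" for z
  define C where "C = norm (f 0) + norm (f1 0) + norm (f2 0)"
  have C: "C \<ge> 0"
    by (simp add: C_def)
  have eq: "f z = p z + z ^ 3 * g z" for z
    using f1(2)[of z] f2(2)[of z] g(2)[of z]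
    by (simp add: p_def algebra_simps power2_eq_square power3_eq_cube)
  have p: "norm (p z) \<le> C * r ^ 2" if "norm z = r" "r \<ge> 1" for z r
  proof -
    have 1: "1 \<le> r ^ 2" "r \<le> r ^ 2"
      using that by (auto intro: self_le_power)
    have "norm (p z) \<le> norm (f 0) + norm (f1 0) * r + norm (f2 0) * r ^ 2"
      unfolding p_def using that(1)
      by (intro order_trans[OF norm_triangle_ineq] add_mono) (auto simp: norm_mult norm_power)
    also have "\<dots> \<le> norm (f 0) * r ^ 2 + norm (f1 0) * r ^ 2 + norm (f2 0) * r ^ 2"
      using 1 by (intro add_mono mult_left_mono) (auto simp: mult_le_cancel_left1)
    finally show ?thesis
      by (simp add: C_def algebra_simps)
  qed
  obtain X where X: "X \<ge> 1" "\<And>r. r \<ge> X \<Longrightarrow> max_modulus g r \<ge> 2 * C"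
    using max_modulus_unbounded[OF g(1), of "2 * C"] by blast
  have hol: "f holomorphic_on UNIV" "g holomorphic_on UNIV"
    using assms g by (auto simp: transcendental_entire_def)
  have small: "C * r ^ 2 \<le> r ^ 3 * max_modulus g r / 2" if "r \<ge> X" for r
  proof -
    have "C * r ^ 2 \<le> (r * C) * r ^ 2"
      using X(1) that C by (intro mult_right_mono) (auto simp: mult_le_cancel_right1)
    also have "\<dots> = r ^ 3 * C"
      by (simp add: power2_eq_square power3_eq_cube)
    also have "\<dots> \<le> r ^ 3 * (max_modulus g r / 2)"
      using X(2)[OF that] X(1) that by (intro mult_left_mono) auto
    finally show ?thesis by simp
  qed
  show ?thesis
  proof (rule that[OF g(1) X(1)])
    fix r assume r: "r \<ge> X"
    then have r0: "r \<ge> 0"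
      using X(1) by linarith
    obtain z where z: "norm z = r" "max_modulus g r = norm (g z)"
      using max_modulus_obtains[OF hol(2), of r] r0 by blast
    have "r ^ 3 * max_modulus g r = norm (f z - p z)"
      using z eq[of z] by (simp add: norm_mult norm_power)
    also have "\<dots> \<le> norm (f z) + norm (p z)"
      by (rule norm_triangle_ineq4)
    also have "\<dots> \<le> max_modulus f r + C * r ^ 2"
      using max_modulus_ge[OF hol(1), of z r] p[OF z(1)] z(1) r X(1) by simp
    finally show "r ^ 3 * max_modulus g r / 2 \<le> max_modulus f r"
      using small[OF r] by simp
  next
    fix r assume r: "r \<ge> X"
    then have r0: "r \<ge> 0"
      using X(1) by linarith
    obtain z where z: "norm z = r" "max_modulus f r = norm (f z)"
      using max_modulus_obtains[OF hol(1), of r] r0 by blast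
    have "norm (f z) \<le> norm (p z) + norm (z ^ 3 * g z)"
      unfolding eq[of z] by (rule norm_triangle_ineq)
    also have "\<dots> \<le> C * r ^ 2 + r ^ 3 * max_modulus g r"
      using max_modulus_ge[OF hol(2), of z r] p[OF z(1)] z(1) r X(1)
      by (auto simp: norm_mult norm_power intro!: add_mono mult_left_mono)
    finally show "max_modulus f r \<le> 3 / 2 * (r ^ 3 * max_modulus g r)"
      using small[OF r] z(2) by simp
  qed
qed

text \<open>Use the lower cubic bound at \<open>c * r\<close> and the upper one at \<open>r\<close>;
  the maximum modulus of \<open>g\<close> only grows in between. The loss 1/3 is the quotient of 1/2
  and 3/2.\<close>

lemma max_modulus_scale:
  assumes "transcendental_entire f"
  obtains X where "X \<ge> 1"
    "\<And>r c. r \<ge> X \<Longrightarrow> c \<ge> 1 \<Longrightarrow> max_modulus f (c * r) \<ge> c ^ 3 * max_modulus f r / 3"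
proof -
  obtain g X where g: "transcendental_entire g" "X \<ge> 1"
      "\<And>r. r \<ge> X \<Longrightarrow> r ^ 3 * max_modulus g r / 2 \<le> max_modulus f r"
      "\<And>r. r \<ge> X \<Longrightarrow> max_modulus f r \<le> 3 / 2 * (r ^ 3 * max_modulus g r)"
    using max_modulus_cubic_bounds[OF assms] by blast
  have hol: "g holomorphic_on UNIV"
    using g(1) by (simp add: transcendental_entire_def)
  show ?thesis
  proof (rule that[OF g(2)])
    fix r c :: real assume r: "r \<ge> X" and c: "c \<ge> 1"
    have rc: "r \<le> c * r"
      using r c g(2) by (simp add: mult_le_cancel_right1)
    have "c ^ 3 * max_modulus f r / 3 \<le> c ^ 3 * (3 / 2 * (r ^ 3 * max_modulus g r)) / 3"
      using g(4)[OF r] c by (intro divide_right_mono mult_left_mono) auto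
    also have "\<dots> = (c * r) ^ 3 * max_modulus g r / 2"
      by (simp add: power_mult_distrib)
    also have "\<dots> \<le> (c * r) ^ 3 * max_modulus g (c * r) / 2"
      using max_modulus_mono[OF hol _ rc] r c g(2) by (intro divide_right_mono mult_left_mono) auto
    also have "\<dots> \<le> max_modulus f (c * r)"
      using g(3)[of "c * r"] r rc by simp
    finally show "max_modulus f (c * r) \<ge> c ^ 3 * max_modulus f r / 3" .
  qed
qed

lemma max_modulus_superlinear:
  assumes "transcendental_entire f"
  obtains X where "X \<ge> 1" "\<And>r. r \<ge> X \<Longrightarrow> max_modulus f r \<ge> K * r"
proof -
  obtain g X where g: "transcendental_entire g" "X \<ge> 1"
      "\<And>r. r \<ge> X \<Longrightarrow> r ^ 3 * max_modulus g r / 2 \<le> max_modulus f r"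
      "\<And>r. r \<ge> X \<Longrightarrow> max_modulus f r \<le> 3 / 2 * (r ^ 3 * max_modulus g r)"
    using max_modulus_cubic_bounds[OF assms] by blast
  obtain Y where Y: "Y \<ge> 1" "\<And>r. r \<ge> Y \<Longrightarrow> max_modulus g r \<ge> 2 * \<bar>K\<bar>"
    using max_modulus_unbounded[OF g(1)] by blast
  show ?thesis
  proof (rule that[of "max X Y"])
    fix r assume r: "r \<ge> max X Y"
    have "K * r \<le> \<bar>K\<bar> * r ^ 3"
      using r g(2) by (intro mult_mono) (auto intro: self_le_power)
    also have "\<dots> \<le> r ^ 3 * (max_modulus g r / 2)"
      using Y(2)[of r] r g(2) by (subst mult.commute, intro mult_left_mono) auto
    also have "\<dots> \<le> max_modulus f r"
      using g(3)[of r] r by simp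
    finally show "max_modulus f r \<ge> K * r" .
  qed (use g in auto)
qed

section \<open>Orbits of the maximum modulus above an admissible level\<close>

lemma admissible_iterates:
  assumes "f holomorphic_on UNIV" and "admissible_level f R" and "r \<ge> R"
  shows "(max_modulus f ^^ n) r \<ge> R \<and> (max_modulus f ^^ n) r \<le> (max_modulus f ^^ Suc n) r"
  proof (induction n)
  case (Suc n)
  then have "(max_modulus f ^^ Suc n) r \<ge> R"
    by linarith
  then show ?case
    using assms(2) by (auto simp: admissible_level_def intro: less_imp_le)
qed (use assms in \<open>auto simp: admissible_level_def intro: less_imp_le\<close>)

text \<open>A bounded orbit would increase to a limit \<open>L\<close> whose maximum modulus exceeds
  \<open>L\<close>, which forces some later iterate above \<open>L\<close>.\<close>

lemma admissible_iterates_unbounded: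
  assumes hol: "f holomorphic_on UNIV" and adm: "admissible_level f R" and r: "r \<ge> R"
  obtains n where "(max_modulus f ^^ n) r > B"
proof (rule ccontr)
  define u where "u n = (max_modulus f ^^ n) r" for n
  assume "\<not> thesis"
  then have bd: "u n \<le> B" for n
    using that unfolding u_def by (meson not_le)
  have inc: "incseq u"
    unfolding u_def using admissible_iterates[OF hol adm r] by (intro incseq_SucI) auto
  then obtain L where L: "u \<longlonglongrightarrow> L"
    using bd incseq_convergent by metis
  have uL: "u n \<le> L" for n
    using incseq_le[OF inc L] .
  have Rp: "R > 0" and LR: "L \<ge> R" and L0: "L \<ge> 0"
    using adm uL[of 0] r by (auto simp: admissible_level_def u_def)
  then have grow: "max_modulus f L > L"
    using adm by (auto simp: admissible_level_def)
  obtain z where z: "norm z = L" "max_modulus f L = norm (f z)"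
    using max_modulus_obtains[OF hol L0] by blast
  have "isCont f z"
    using hol by (metis UNIV_I continuous_on_eq_continuous_at holomorphic_on_imp_continuous_on open_UNIV)
  \<comment> \<open>Shrinking the maximizing point \<open>z\<close> radially to modulus
    \<open>u n\<close> transfers continuity of \<open>f\<close> at \<open>z\<close> to the
    orbit.\<close>
  moreover have "(\<lambda>n. (u n / L) *\<^sub>R z) \<longlonglongrightarrow> z"
    using tendsto_scaleR[OF tendsto_divide[OF L tendsto_const, of L] tendsto_const, of z] Rp LR by simp
  ultimately have "(\<lambda>n. norm (f ((u n / L) *\<^sub>R z))) \<longlonglongrightarrow> norm (f z)"
    by (intro tendsto_norm isCont_tendsto_compose[of z f])
  then have "\<forall>\<^sub>F n in sequentially. norm (f ((u n / L) *\<^sub>R z)) > L"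
    using grow z(2) by (intro order_tendstoD(1)) simp_all
  then obtain n where n: "norm (f ((u n / L) *\<^sub>R z)) > L"
    by (auto simp: eventually_sequentially)
  have "u n \<ge> R"
    using admissible_iterates[OF hol adm r] by (simp add: u_def)
  then have "norm ((u n / L) *\<^sub>R z) = u n"
    using z Rp LR by simp
  then have "norm (f ((u n / L) *\<^sub>R z)) \<le> u (Suc n)"
    using max_modulus_ge[OF hol, of "(u n / L) *\<^sub>R z" "u n"] by (simp add: u_def)
  then show False
    using n uL[of "Suc n"] by simp
qed

section \<open>The comparison of iterates\<close>

text \<open>A delay of \<open>k\<close> steps is absorbed into \<open>l\<close>, so a comparison of
  levels up to a shift yields an inclusion of sets.\<close>

lemma escape_delay:
  fixes u v :: "nat \<Rightarrow> real"
  assumes "\<And>n. u n \<le> v (n + k)"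
    and "\<exists>l\<ge>1. \<forall>n\<ge>1. norm ((f ^^ (n + l)) z) \<ge> v n"
  shows "\<exists>l\<ge>1. \<forall>n\<ge>1. norm ((f ^^ (n + l)) z) \<ge> u n"
proof -
  obtain l where l: "l \<ge> 1" "\<And>n. n \<ge> 1 \<Longrightarrow> norm ((f ^^ (n + l)) z) \<ge> v n"
    using assms(2) by blast
  have "norm ((f ^^ (n + (k + l))) z) \<ge> u n" if "n \<ge> 1" for n
    using l(2)[of "n + k"] assms(1)[of n] that by (simp add: add.assoc)
  then show ?thesis
    using l(1) by (intro exI[of _ "k + l"]) auto
qed

lemma iterates_delay:
  assumes hol: "f holomorphic_on UNIV" and adm: "admissible_level f R" and "r \<ge> R" and "B \<ge> 0"
  obtains k where "\<And>n. (max_modulus f ^^ n) B \<le> (max_modulus f ^^ (n + k)) r"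
proof -
  obtain k where "B < (max_modulus f ^^ k) r"
    using admissible_iterates_unbounded[OF hol adm assms(3), of B] by blast
  then have "(max_modulus f ^^ n) B \<le> (max_modulus f ^^ (n + k)) r" for n
    using max_modulus_le_iterates[OF hol assms(4), of "(max_modulus f ^^ k) r" n]
    by (simp add: funpow_add)
  then show ?thesis
    using that by blast
qed

section \<open>Lower bounds along the orbit of \<open>\<eta>\<close>\<close>

text \<open>Locate \<open>r\<close> between the orbit points of index \<open>k + j\<close> and
  \<open>k + j + 1\<close>. Then \<open>\<epsilon> r\<close> is at least
  \<open>a ^ (k + j + 2)\<close> and \<open>r\<close> at least \<open>(2 / a) ^ j * b\<close>, so
  the product is at least a fixed multiple of \<open>2 ^ j\<close>.\<close>

lemma eps_times_radius_large:
  assumes tr: "transcendental_entire f"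
    and adm: "admissible_level f S"
    and a: "0 < \<epsilon> S"  "\<epsilon> S < 1"
    and anti: "antimono_on {S..} \<epsilon>"
    and eps: "\<And>n. n \<ge> 1 \<Longrightarrow> \<epsilon> ((max_modulus f ^^ n) S) \<ge> \<epsilon> S ^ (n + 1)"
  obtains R1 where "R1 \<ge> S" "\<And>r. r \<ge> R1 \<Longrightarrow> \<epsilon> r * r \<ge> B"
proof -
  define M where "M = max_modulus f"
  define a where "a = \<epsilon> S"
  have a01: "0 < a" "a < 1"
    using assms(3,4) by (auto simp: a_def)
  have hol: "f holomorphic_on UNIV"
    using tr by (simp add: transcendental_entire_def)
  note it = admissible_iterates[OF hol adm order_refl, folded M_def]
  have inc: "incseq (\<lambda>n. (M ^^ n) S)"
    using it by (intro incseq_SucI) auto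
  \<comment> \<open>With growth rate \<open>2 / a\<close>, each step of the orbit makes up for one
    factor \<open>a\<close> lost in \<open>\<epsilon>\<close> and still gains a factor 2.\<close>
  obtain X where X: "X \<ge> 1" "\<And>r. r \<ge> X \<Longrightarrow> M r \<ge> (2 / a) * r"
    using max_modulus_superlinear[OF tr, of "2 / a"] unfolding M_def by blast
  obtain k where k: "(M ^^ k) S > X"
    using admissible_iterates_unbounded[OF hol adm order_refl, of X] unfolding M_def by blast
  define b where "b = (M ^^ k) S"
  have growth: "(M ^^ (k + j)) S \<ge> (2 / a) ^ j * b" for j
  proof (induction j)
    case (Suc j)
    have "(M ^^ (k + j)) S \<ge> b"
      unfolding b_def using incseqD[OF inc, of k "k + j"] by simp
    then have "(2 / a) * (M ^^ (k + j)) S \<le> M ((M ^^ (k + j)) S)"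
      using k by (intro X(2)) (simp add: b_def)
    moreover have "(2 / a) * ((2 / a) ^ j * b) \<le> (2 / a) * (M ^^ (k + j)) S"
      using Suc.IH a01 by (intro mult_left_mono) auto
    ultimately show ?case
      by simp
  qed (simp add: b_def)
  have c: "b * a ^ (k + 2) > 0"
    using k X(1) a01 by (simp add: b_def)
  obtain i where i: "B / (b * a ^ (k + 2)) < 2 ^ i"
    using real_arch_pow[of 2] by auto
  show ?thesis
  proof (rule that[of "(M ^^ (k + i)) S"])
    show "(M ^^ (k + i)) S \<ge> S"
      using it by simp
  next
    fix r assume r: "r \<ge> (M ^^ (k + i)) S"
    \<comment> \<open>The first orbit point beyond \<open>r\<close>: there the iterate hypothesis
      bounds \<open>\<epsilon>\<close> from below, and monotonicity passes the bound back to
      \<open>r\<close>.\<close>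
    define m where "m = (LEAST m. (M ^^ m) S > r)"
    obtain m' where "(M ^^ m') S > r"
      using admissible_iterates_unbounded[OF hol adm order_refl, of r] unfolding M_def by blast
    then have m: "(M ^^ m) S > r"
      unfolding m_def by (rule LeastI)
    have "m > k + i"
    proof (rule ccontr)
      assume "\<not> m > k + i"
      then have "(M ^^ m) S \<le> (M ^^ (k + i)) S"
        using incseqD[OF inc, of m "k + i"] by simp
      then show False
        using m r by simp
    qed
    then obtain j' where "m = Suc (k + i) + j'"
      using less_iff_Suc_add by auto
    then obtain j where j: "m = Suc (k + j)" "j \<ge> i"
      by (metis add.assoc add_Suc le_add1)
    have lo: "(M ^^ (k + j)) S \<le> r"
      using not_less_Least[of "k + j" "\<lambda>m. (M ^^ m) S > r", folded m_def] j by simp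
    have "r \<ge> S"
      using it[of "k + j"] lo by simp
    then have "\<epsilon> ((M ^^ m) S) \<le> \<epsilon> r"
      using anti m by (intro monotone_onD[OF anti]) auto
    moreover have "\<epsilon> ((M ^^ m) S) \<ge> a ^ (m + 1)"
      using eps[of m] j unfolding M_def a_def by simp
    ultimately have er: "\<epsilon> r \<ge> a ^ (k + j + 2)"
      using j by simp
    have "B \<le> 2 ^ i * (b * a ^ (k + 2))"
      using i c by (simp add: divide_less_eq)
    also have "\<dots> \<le> 2 ^ j * (b * a ^ (k + 2))"
      using j c by (intro mult_right_mono) (auto intro: power_increasing)
    also have "\<dots> = a ^ (k + j + 2) * ((2 / a) ^ j * b)"
      using a01 by (simp add: power_add power_divide field_simps)
    also have "\<dots> \<le> \<epsilon> r * r"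
      using er growth[of j] lo a01 k X(1)
      by (intro mult_mono order_trans[OF _ er]) (auto simp: b_def)
    finally show "\<epsilon> r * r \<ge> B" .
  qed
qed

lemma eta_iterates_lower:
  assumes hol: "f holomorphic_on UNIV"
    and adm: "admissible_level f S" and "S \<ge> R0"
    and eps: "\<And>r. r \<ge> R0 \<Longrightarrow> 0 < \<epsilon> r \<and> \<epsilon> r < 1"
    and anti: "antimono_on {R0..} \<epsilon>"
    and iter: "\<And>r n. r \<ge> R0 \<Longrightarrow> n \<ge> 1 \<Longrightarrow> \<epsilon> ((max_modulus f ^^ n) r) \<ge> \<epsilon> r ^ (n + 1)"
    and eta: "\<And>r. r \<ge> R0 \<Longrightarrow> \<eta> r = \<epsilon> r * max_modulus f r"
    and scale: "\<And>r c. r \<ge> S \<Longrightarrow> c \<ge> 1 \<Longrightarrow> max_modulus f (c * r) \<ge> c ^ 3 * max_modulus f r / 3"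
    and R': "R' \<ge> R0" and s: "\<epsilon> R' * R' / 3 \<ge> S"
  shows "(\<eta> ^^ n) R' \<ge> R0 \<and> (\<eta> ^^ n) R' \<le> (max_modulus f ^^ n) R' \<and>
         (\<eta> ^^ n) R' \<ge> (max_modulus f ^^ n) (\<epsilon> R' * R' / 3)"
proof -
  define M where "M = max_modulus f"
  define d where "d = \<epsilon> R'"
  define s where "s = d * R' / 3"
  have d: "0 < d" "d < 1"
    using eps[OF R'] by (auto simp: d_def)
  have S: "S > 0"
    using adm by (simp add: admissible_level_def)
  have y: "(M ^^ n) s \<ge> S" for n
    using admissible_iterates[OF hol adm, of s n] assms(10) by (simp add: M_def s_def d_def)
  have c: "3 / d \<ge> 1"
    using d by simp
  have ge_y: "x \<ge> (M ^^ n) s" if "x \<ge> (3 / d) ^ (n + 1) * (M ^^ n) s" for n x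
  proof -
    have "1 \<le> (3 / d) ^ (n + 1)"
      using c by (rule one_le_power)
    then have "1 * (M ^^ n) s \<le> (3 / d) ^ (n + 1) * (M ^^ n) s"
      using y[of n] S by (intro mult_right_mono) auto
    then show ?thesis
      using that by simp
  qed
  \<comment> \<open>The extra factor makes the induction close; at \<open>n = 0\<close> the lower
    bound is an equality by the choice of \<open>s\<close>. The upper bound is carried along to
    control \<open>\<epsilon>\<close> at the iterate.\<close>
  have main: "(\<eta> ^^ n) R' \<ge> (3 / d) ^ (n + 1) * (M ^^ n) s \<and> (\<eta> ^^ n) R' \<le> (M ^^ n) R'" for n
  proof (induction n)
    case 0
    show ?case
      using d by (simp add: s_def)
  next
    case (Suc n)
    define x where "x = (\<eta> ^^ n) R'"
    have x: "x \<ge> (3 / d) ^ (n + 1) * (M ^^ n) s" "x \<le> (M ^^ n) R'"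
      using Suc by (auto simp: x_def)
    have xS: "x \<ge> S" and xR: "x \<ge> R0"
      using ge_y[OF x(1)] y[of n] \<open>S \<ge> R0\<close> by auto
    have Mx: "0 \<le> M x" "M x \<le> M ((M ^^ n) R')"
      using max_modulus_mono[OF hol _ x(2)] max_modulus_nonneg[OF hol] xS S by (auto simp: M_def)
    have ex: "\<epsilon> x \<ge> d ^ (n + 1)"
    proof -
      have "\<epsilon> ((M ^^ n) R') \<ge> d ^ (n + 1)"
        \<comment> \<open>The hypothesis starts at \<open>n = 1\<close>; for \<open>n = 0\<close>
          the claim is \<open>\<epsilon> R' \<ge> d\<close>.\<close>
        using iter[OF R', of n] by (cases "n = 0") (auto simp: d_def M_def)
      moreover have "\<epsilon> ((M ^^ n) R') \<le> \<epsilon> x"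
        using xR x(2) by (intro monotone_onD[OF anti]) auto
      ultimately show ?thesis by simp
    qed
    \<comment> \<open>Exponent count: of the cubed factor, one copy cancels
      \<open>d ^ (n + 1)\<close> and leaves \<open>3 ^ n\<close> after division by 3; the other two
      give exponent \<open>2 * (n + 1)\<close>, at least the required \<open>n + 2\<close>.\<close>
    have "3 / d * (3 / d) ^ (n + 1) \<le> (3 / d) ^ (n + 1) * (3 / d) ^ (n + 1)"
      using c d self_le_power[OF c, of "n + 1"] by (intro mult_right_mono) auto
    also have "\<dots> \<le> (3 / d) ^ (n + 1) * (3 / d) ^ (n + 1) * 3 ^ n"
      using mult_left_mono[of 1 "3 ^ n" "(3 / d) ^ (n + 1) * (3 / d) ^ (n + 1)"] d by simp
    also have "\<dots> = d ^ (n + 1) * (((3 / d) ^ (n + 1)) ^ 3 / 3)"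
      using d by (simp add: power3_eq_cube power_divide field_simps)
    finally have "(3 / d) ^ (Suc n + 1) * M ((M ^^ n) s) \<le>
        d ^ (n + 1) * (((3 / d) ^ (n + 1)) ^ 3 / 3) * M ((M ^^ n) s)"
      using y[of "Suc n"] S by (intro mult_right_mono) auto
    also have "\<dots> = d ^ (n + 1) * (((3 / d) ^ (n + 1)) ^ 3 * M ((M ^^ n) s) / 3)"
      by simp
    also have "\<dots> \<le> d ^ (n + 1) * M ((3 / d) ^ (n + 1) * (M ^^ n) s)"
      unfolding M_def using d y[of n] c
      by (intro mult_left_mono scale one_le_power) (auto simp: M_def)
    also have "\<dots> \<le> d ^ (n + 1) * M x"
      unfolding M_def using d y[of n] S x(1)
      by (intro mult_left_mono max_modulus_mono[OF hol]) (auto simp: M_def)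
    also have "\<dots> \<le> \<epsilon> x * M x"
      using ex Mx by (intro mult_right_mono) auto
    also have "\<dots> = \<eta> x"
      using eta[OF xR] by (simp add: M_def)
    finally have lo: "(3 / d) ^ (Suc n + 1) * M ((M ^^ n) s) \<le> \<eta> x" .
    have "\<eta> x \<le> 1 * M x"
      unfolding eta[OF xR] M_def[symmetric] using eps[OF xR] Mx by (intro mult_right_mono) auto
    then show ?case
      using lo Mx by (simp add: x_def)
  qed
  show ?thesis
    using main[of n] ge_y[of n "(\<eta> ^^ n) R'"] y[of n] \<open>S \<ge> R0\<close> by (auto simp: M_def s_def d_def)
qed

text \<open>Functions are total here, so that the iterates of \<open>\<eta>\<close> are defined is
  expressed by their staying in \<open>{R0..}\<close>.\<close>

theorem theorem2:
  fixes f :: "complex \<Rightarrow> complex" and R0 :: real and \<epsilon> \<eta> :: "real \<Rightarrow> real"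
  assumes "transcendental_entire f"
    and "R0 > 0"
    and "\<And>r. r \<ge> R0 \<Longrightarrow> 0 < \<epsilon> r \<and> \<epsilon> r < 1"
    and "antimono_on {R0..} \<epsilon>"
    and "\<And>r n. r \<ge> R0 \<Longrightarrow> n \<ge> 1 \<Longrightarrow>
           (max_modulus f ^^ n) r \<ge> R0 \<and> \<epsilon> ((max_modulus f ^^ n) r) \<ge> \<epsilon> r ^ (n + 1)"
    and "\<And>r. r \<ge> R0 \<Longrightarrow> \<eta> r = \<epsilon> r * max_modulus f r"
  shows "\<exists>R1\<ge>R0. \<forall>R'\<ge>R1.
           (\<forall>n. (\<eta> ^^ n) R' \<ge> R0) \<and>
           (\<forall>R. admissible_level f R \<longrightarrow>
              fast_escaping_set f R =
                {z. \<exists>l\<ge>1. \<forall>n\<ge>1. norm ((f ^^ (n + l)) z) \<ge> (\<eta> ^^ n) R'})"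
proof -
  note tr = assms(1) and eps = assms(3) and anti = assms(4) and iter = assms(5) and eta = assms(6)
  have hol: "f holomorphic_on UNIV"
    using tr by (simp add: transcendental_entire_def)
  obtain X where X: "X \<ge> 1"
      "\<And>r c. r \<ge> X \<Longrightarrow> c \<ge> 1 \<Longrightarrow> max_modulus f (c * r) \<ge> c ^ 3 * max_modulus f r / 3"
    using max_modulus_scale[OF tr] by blast
  obtain Y where Y: "Y \<ge> 1" "\<And>r. r \<ge> Y \<Longrightarrow> max_modulus f r \<ge> 2 * r"
    using max_modulus_superlinear[OF tr] by blast
  \<comment> \<open>Above \<open>S\<close>, \<open>\<epsilon>\<close> is controlled
    (\<open>R0\<close>), the scaling estimate holds (\<open>X\<close>), and the level is admissible
    (\<open>Y\<close>).\<close>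
  define S where "S = Max {R0, X, Y}"
  have S: "S \<ge> R0" "S \<ge> X" "S \<ge> Y"
    by (auto simp: S_def)
  have adm: "admissible_level f S"
    unfolding admissible_level_def
  proof (intro conjI allI impI)
    show "r < max_modulus f r" if "S \<le> r" for r
      using Y(2)[of r] Y(1) S(3) that by linarith
  qed (use S X(1) in auto)
  have anti': "antimono_on {S..} \<epsilon>"
    using S(1) by (intro monotone_on_subset[OF anti]) auto
  \<comment> \<open>The factor 3 places the starting point \<open>\<epsilon> R' * R' / 3\<close> at
    or above \<open>S\<close>.\<close>
  obtain R1 where R1: "R1 \<ge> S" "\<And>r. r \<ge> R1 \<Longrightarrow> \<epsilon> r * r \<ge> 3 * S"
    using eps_times_radius_large[of f S \<epsilon> "3 * S"] tr adm eps[OF S(1)] anti' iter[OF S(1)] by blast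
  show ?thesis
  proof (intro exI[of _ R1] conjI allI impI)
    show "R1 \<ge> R0"
      using R1(1) S(1) by simp
  next
    fix R' assume "R' \<ge> R1"
    then have R': "R' \<ge> R0" "\<epsilon> R' * R' / 3 \<ge> S"
      using R1(1) R1(2)[of R'] S(1) by auto
    have lower: "(\<eta> ^^ n) R' \<ge> R0" "(\<eta> ^^ n) R' \<le> (max_modulus f ^^ n) R'"
        "(\<eta> ^^ n) R' \<ge> (max_modulus f ^^ n) (\<epsilon> R' * R' / 3)" for n
      using eta_iterates_lower[OF hol adm S(1) eps anti _ eta X(2) R', of n] iter S(2) by auto
    show "(\<eta> ^^ n) R' \<ge> R0" for n
      by (rule lower)
    fix R assume admR: "admissible_level f R"
    then have "R > 0"
      by (simp add: admissible_level_def)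
    \<comment> \<open>Two delays, one per inclusion: the orbit of \<open>R\<close> overtakes
      \<open>R'\<close>, and that of \<open>\<epsilon> R' * R' / 3\<close> overtakes
      \<open>R\<close>.\<close>
    obtain k where k: "\<And>n. (max_modulus f ^^ n) R' \<le> (max_modulus f ^^ (n + k)) R"
      using iterates_delay[OF hol admR order_refl, of R'] R'(1) assms(2) by auto
    obtain j where j: "\<And>n. (max_modulus f ^^ n) R \<le> (max_modulus f ^^ (n + j)) (\<epsilon> R' * R' / 3)"
      using iterates_delay[OF hol adm R'(2), of R] \<open>R > 0\<close> by auto
    have "(\<eta> ^^ n) R' \<le> (max_modulus f ^^ (n + k)) R" for n
      using order_trans[OF lower(2) k] .
    moreover have "(max_modulus f ^^ n) R \<le> (\<eta> ^^ (n + j)) R'" for n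
      using order_trans[OF j lower(3)] .
    ultimately show "fast_escaping_set f R =
        {z. \<exists>l\<ge>1. \<forall>n\<ge>1. norm ((f ^^ (n + l)) z) \<ge> (\<eta> ^^ n) R'}"
      unfolding fast_escaping_set_def
      by (intro Collect_cong iffI) (erule escape_delay[rotated], assumption)+
  qed
qed

end
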